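(* Let $n\ge 1$ be an integer, $\kappa>0$, let $C\subset\mathbb{H}^n_\kappa$ be a closed $\kappa$-hyperbolically convex set and $f:\mathbb{H}^n_\kappa\to\mathbb{R}$ a differentiable function such that the problem of minimizing $f$ over $C$ has a nonempty solution set, with optimum value $f^*:=\inf_{p\in C}f(p)>-\infty$. Assume that $\operatorname{grad} f$ is Lipschitz continuous on $C$ with constant $L\ge 0$. Let $(p_k)_{k\in\mathbb{N}}$ and $(z_k)_{k\in\mathbb{N}}$ be infinite sequences generated by the gradient projection method with backtracking step size (described in the context, with parameters $\rho,\beta,\theta_0,\hat\alpha,\bar\alpha$) applied to $f$ and $C$, with $\operatorname{grad} f(p_k)\neq 0$ for all $k$. Set $\bar\theta:=\min\{\theta_0,\frac{2}{\bar\alpha L}(1-\rho)\}$ (with $\bar\theta:=\theta_0$ if $L=0$). Then for all $N\in\mathbb{N}$, $$\min\{d_\kappa(p_k,z_k):k=0,1,\dots,N\}\le\frac{\sqrt{\bar\alpha(f(p_0)-f^* )}}{\sqrt{\rho\beta\bar\theta}}\,\frac{1}{\sqrt{N+1}}.$$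
   Context: For $x,y\in\mathbb{R}^{n+1}$ the Lorentzian inner product is $\langle x,y\rangle:=x_1y_1+\dots+x_ny_n-x_{n+1}y_{n+1}$. The $\kappa$-hyperbolic space form is $\mathbb{H}^n_\kappa:=\{p\in\mathbb{R}^{n+1}:\langle p,p\rangle=-1/\kappa,\ p_{n+1}>0\}$, with tangent space $T_p\mathbb{H}^n_\kappa:=\{v\in\mathbb{R}^{n+1}:\langle p,v\rangle=0\}$, on which $\langle\cdot,\cdot\rangle$ is positive definite (a Riemannian metric), with norm $\|v\|=\sqrt{\langle v,v\rangle}$. The intrinsic distance is $d_\kappa(p,q):=\frac{1}{\sqrt\kappa}\operatorname{arcosh}(-\kappa\langle p,q\rangle)$. Exponential map: $\exp^\kappa_p(0)=p$ and $\exp^\kappa_p(v)=\cosh(\sqrt\kappa\|v\|)\,p+\sinh(\sqrt\kappa\|v\|)\frac{v}{\sqrt\kappa\|v\|}$ for $0\ne v\in T_p\mathbb{H}^n_\kappa$. Its inverse is $\log^\kappa_p p=0$ and $\log^\kappa_p q=d_\kappa(p,q)\frac{q+\kappa\langle p,q\rangle p}{\|q+\kappa\langle p,q\rangle p\|}$ for $q\ne p$. The geodesic segment joining $p$ to $q$ is $\{\exp^\kappa_p(t\log^\kappa_p q):t\in[0,1]\}$. A set $C\subseteq\mathbb{H}^n_\kappa$ is $\kappa$-hyperbolically convex if for all $p,q\in C$ the geodesic segment joining $p$ to $q$ is contained in $C$. For a nonempty closed $\kappa$-hyperbolically convex set $C$, the intrinsic $\kappa$-projection $P^\kappa_C(p)$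 of $p\in\mathbb{H}^n_\kappa$ is the unique minimizer of $q\mapsto d_\kappa(p,q)$ over $q\in C$. $\operatorname{grad} f(p)\in T_p\mathbb{H}^n_\kappa$ is the Riemannian gradient: $df(p)v=\langle\operatorname{grad} f(p),v\rangle$ for all $v\in T_p\mathbb{H}^n_\kappa$. Parallel transport $P_{pq}:T_p\mathbb{H}^n_\kappa\to T_q\mathbb{H}^n_\kappa$ is $P_{pq}(v)=v-\frac{\kappa\langle q,v\rangle}{\kappa\langle p,q\rangle-1}(p+q)$. $\operatorname{grad} f$ is Lipschitz continuous on $C$ with constant $L$ if $\|P_{pq}\operatorname{grad} f(p)-\operatorname{grad} f(q)\|\le L\,d_\kappa(p,q)$ for all $p,q\in C$. Gradient projection method with backtracking step size: fix constants $\rho,\beta,\theta_0\in(0,1)$ and $\hat\alpha,\bar\alpha>0$, and an initial point $p_0\in C$. For $k=0,1,2,\dots$: choose any $\alpha_k$ with $0<\hat\alpha\le\alpha_k\le\bar\alpha$; set $y_k:=\exp^\kappa_{p_k}(-\alpha_k\operatorname{grad} f(p_k))$ and $z_k:=P^\kappa_C(y_k)$; let $q_k(\tau):=\exp^\kappa_{p_k}(\tau\log^\kappa_{p_k}z_k)$ and $$\ell_k:=\min\big\{\ell\in\{1,2,\dots\}: f(q_k(\beta^\ell\theta_k))\le f(p_k)+\rho\,\beta^\ell\theta_k\langle\operatorname{grad} f(p_k),\log^\kappa_{p_k}z_k\rangle\big\};$$ set $p_{k+1}:=q_k(\beta^{\ell_k}\theta_k)$ and $\theta_{k+1}:=\beta^{\ell_k-1}\theta_k$.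 (The method stops if $\operatorname{grad} f(p_k)=0$.) *)

theory Defs
  imports "HOL-Analysis.Analysis"
begin

text \<open>The ambient space of dimension n + 1 is the type \<open>(real ^ 'n) \<times> real\<close> with n = \<open>CARD('n)\<close>;
  the second component is the last (time-like) coordinate.\<close>

definition lorentz :: "(real ^ 'n) \<times> real \<Rightarrow> (real ^ 'n) \<times> real \<Rightarrow> real"
  where "lorentz x y = fst x \<bullet> fst y - snd x * snd y"

definition hyperboloid :: "real \<Rightarrow> ((real ^ 'n) \<times> real) set"
  where "hyperboloid \<kappa> = {p. lorentz p p = - 1 / \<kappa> \<and> snd p > 0}"

definition tangent :: "(real ^ 'n) \<times> real \<Rightarrow> ((real ^ 'n) \<times> real) set"
  where "tangent p = {v. lorentz p v = 0}"

text \<open>Only meaningful on tangent vectors, where the Lorentzian product is positive definite.\<close>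

definition lnorm :: "(real ^ 'n) \<times> real \<Rightarrow> real"
  where "lnorm v = sqrt (lorentz v v)"

definition hyp_dist :: "real \<Rightarrow> (real ^ 'n) \<times> real \<Rightarrow> (real ^ 'n) \<times> real \<Rightarrow> real"
  where "hyp_dist \<kappa> p q = 1 / sqrt \<kappa> * arcosh (- \<kappa> * lorentz p q)"

definition hyp_exp ::
    "real \<Rightarrow> (real ^ 'n) \<times> real \<Rightarrow> (real ^ 'n) \<times> real \<Rightarrow> (real ^ 'n) \<times> real"
  where "hyp_exp \<kappa> p v =
    (if v = 0 then p
     else cosh (sqrt \<kappa> * lnorm v) *\<^sub>R p
          + (sinh (sqrt \<kappa> * lnorm v) / (sqrt \<kappa> * lnorm v)) *\<^sub>R v)"

definition hyp_log ::
    "real \<Rightarrow> (real ^ 'n) \<times> real \<Rightarrow> (real ^ 'n) \<times> real \<Rightarrow> (real ^ 'n) \<times> real"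
  where "hyp_log \<kappa> p q =
    (if q = p then 0
     else (hyp_dist \<kappa> p q / lnorm (q + (\<kappa> * lorentz p q) *\<^sub>R p))
          *\<^sub>R (q + (\<kappa> * lorentz p q) *\<^sub>R p))"

definition hyp_geodesic ::
    "real \<Rightarrow> (real ^ 'n) \<times> real \<Rightarrow> (real ^ 'n) \<times> real \<Rightarrow> real \<Rightarrow> (real ^ 'n) \<times> real"
  where "hyp_geodesic \<kappa> p q t = hyp_exp \<kappa> p (t *\<^sub>R hyp_log \<kappa> p q)"

definition hyp_convex :: "real \<Rightarrow> ((real ^ 'n) \<times> real) set \<Rightarrow> bool"
  where "hyp_convex \<kappa> C \<longleftrightarrow>
    C \<subseteq> hyperboloid \<kappa> \<and> (\<forall>p\<in>C. \<forall>q\<in>C. hyp_geodesic \<kappa> p q ` {0..1} \<subseteq> C)"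

definition hyp_proj ::
    "real \<Rightarrow> ((real ^ 'n) \<times> real) set \<Rightarrow> (real ^ 'n) \<times> real \<Rightarrow> (real ^ 'n) \<times> real"
  where "hyp_proj \<kappa> C p = (THE q. is_arg_min (hyp_dist \<kappa> p) (\<lambda>q. q \<in> C) q)"

text \<open>A function on the hyperboloid is represented by a function on the ambient space of which
  only the values on the hyperboloid matter.  Since the hyperboloid is an embedded submanifold,
  differentiability at \<open>p\<close> is Frechet differentiability at \<open>p\<close> within the hyperboloid.
  The ambient derivative \<open>D\<close> below is determined only on \<open>tangent p\<close>, where it is the
  differential of \<open>f\<close> at \<open>p\<close>.\<close>

definition has_hyp_grad ::
    "real \<Rightarrow> ((real ^ 'n) \<times> real \<Rightarrow> real) \<Rightarrow> (real ^ 'n) \<times> real \<Rightarrow> (real ^ 'n) \<times> real \<Rightarrow> bool"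
  where "has_hyp_grad \<kappa> f p g \<longleftrightarrow>
    g \<in> tangent p \<and>
    (\<exists>D. (f has_derivative D) (at p within hyperboloid \<kappa>) \<and>
         (\<forall>v\<in>tangent p. D v = lorentz g v))"

definition hyp_grad ::
    "real \<Rightarrow> ((real ^ 'n) \<times> real \<Rightarrow> real) \<Rightarrow> (real ^ 'n) \<times> real \<Rightarrow> (real ^ 'n) \<times> real"
  where "hyp_grad \<kappa> f p = (THE g. has_hyp_grad \<kappa> f p g)"

definition hyp_transport ::
    "real \<Rightarrow> (real ^ 'n) \<times> real \<Rightarrow> (real ^ 'n) \<times> real \<Rightarrow> (real ^ 'n) \<times> real \<Rightarrow> (real ^ 'n) \<times> real"
  where "hyp_transport \<kappa> p q v =
    v - (\<kappa> * lorentz q v / (\<kappa> * lorentz p q - 1)) *\<^sub>R (p + q)"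

definition hyp_grad_lipschitz_on ::
    "real \<Rightarrow> real \<Rightarrow> ((real ^ 'n) \<times> real) set \<Rightarrow> ((real ^ 'n) \<times> real \<Rightarrow> real) \<Rightarrow> bool"
  where "hyp_grad_lipschitz_on \<kappa> L C f \<longleftrightarrow>
    (\<forall>p\<in>C. \<forall>q\<in>C.
       lnorm (hyp_transport \<kappa> p q (hyp_grad \<kappa> f p) - hyp_grad \<kappa> f q) \<le> L * hyp_dist \<kappa> p q)"

text \<open>\<open>p\<close>, \<open>y\<close>, \<open>z\<close>, \<open>l\<close>, \<open>\<theta>\<close>, \<open>\<alpha>\<close> are the sequences of an infinite run of the gradient projection
  method with backtracking; \<open>\<alpha>lo\<close> and \<open>\<alpha>hi\<close> bound the freely chosen steps \<open>\<alpha> k\<close>.\<close>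

definition grad_proj_backtracking_run ::
    "real \<Rightarrow> ((real ^ 'n) \<times> real) set \<Rightarrow> ((real ^ 'n) \<times> real \<Rightarrow> real) \<Rightarrow>
     real \<Rightarrow> real \<Rightarrow> real \<Rightarrow> real \<Rightarrow> real \<Rightarrow>
     (nat \<Rightarrow> real) \<Rightarrow> (nat \<Rightarrow> real) \<Rightarrow> (nat \<Rightarrow> nat) \<Rightarrow>
     (nat \<Rightarrow> (real ^ 'n) \<times> real) \<Rightarrow> (nat \<Rightarrow> (real ^ 'n) \<times> real) \<Rightarrow> (nat \<Rightarrow> (real ^ 'n) \<times> real) \<Rightarrow> bool"
  where "grad_proj_backtracking_run \<kappa> C f \<rho> \<beta> \<theta>0 \<alpha>lo \<alpha>hi \<alpha> \<theta> l p y z \<longleftrightarrow>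
    p 0 \<in> C \<and> \<theta> 0 = \<theta>0 \<and>
    (\<forall>k. \<alpha>lo \<le> \<alpha> k \<and> \<alpha> k \<le> \<alpha>hi \<and>
         y k = hyp_exp \<kappa> (p k) (- \<alpha> k *\<^sub>R hyp_grad \<kappa> f (p k)) \<and>
         z k = hyp_proj \<kappa> C (y k) \<and>
         l k = (LEAST j. 1 \<le> j \<and>
                  f (hyp_geodesic \<kappa> (p k) (z k) (\<beta> ^ j * \<theta> k))
                    \<le> f (p k) + \<rho> * \<beta> ^ j * \<theta> k
                               * lorentz (hyp_grad \<kappa> f (p k)) (hyp_log \<kappa> (p k) (z k))) \<and>
         p (Suc k) = hyp_geodesic \<kappa> (p k) (z k) (\<beta> ^ l k * \<theta> k) \<and>
         \<theta> (Suc k) = \<beta> ^ (l k - 1) * \<theta> k)"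

end

theory Submission
  imports Defs
begin

text \<open>If \<open>z\<close> is the projection onto \<open>C\<close> of \<open>y = exp\<^sub>p w\<close> with \<open>p \<in> C\<close>, the geodesic triangle with
  vertices \<open>p\<close>, \<open>z\<close>, \<open>y\<close> has an angle of at least \<open>\<pi> / 2\<close> at \<open>z\<close>, and the hyperbolic law of cosines
  yields \<open>d(p, z)\<^sup>2 \<le> \<langle>w, log\<^sub>p z\<rangle>\<close>.  For the gradient step \<open>w = - \<alpha> grad f(p)\<close> the direction \<open>log\<^sub>p z\<close>
  therefore has slope at most \<open>- d(p, z)\<^sup>2 / \<alpha>\<close>.  Lipschitz continuity of the gradient bounds
  \<open>f\<close> along a geodesic by its second-order model, so every step \<open>t \<le> 2 (1 - \<rho>) / (\<alpha>hi L)\<close> passes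
  the Armijo test.  Hence the accepted steps never fall below \<open>\<beta> \<theta>bar\<close>, and summing the
  resulting decrease of \<open>f\<close> over the iterations gives the rate.\<close>

section \<open>The Lorentzian product and its restriction to tangent spaces\<close>

lemma lorentz_simps:
  "lorentz (x + y) w = lorentz x w + lorentz y w"
  "lorentz w (x + y) = lorentz w x + lorentz w y"
  "lorentz (x - y) w = lorentz x w - lorentz y w"
  "lorentz w (x - y) = lorentz w x - lorentz w y"
  "lorentz (c *\<^sub>R x) w = c * lorentz x w"
  "lorentz w (c *\<^sub>R x) = c * lorentz w x"
  "lorentz 0 w = 0" "lorentz w 0 = 0"
  by (simp_all add: lorentz_def inner_left_distrib inner_right_distrib
      inner_diff_left inner_diff_right algebra_simps)

lemma lorentz_commute: "lorentz x y = lorentz y x"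
  by (simp add: lorentz_def inner_commute)

lemma lorentz_self: "lorentz x x = (norm (fst x))\<^sup>2 - (snd x)\<^sup>2"
  by (simp add: lorentz_def power2_norm_eq_inner power2_eq_square[of "snd x"])

lemma hyperboloidD:
  assumes "p \<in> hyperboloid \<kappa>"
  shows "lorentz p p = - 1 / \<kappa>" "snd p > 0"
  using assms by (auto simp: hyperboloid_def)

lemma norm_fst_less_snd:
  assumes "\<kappa> > 0" "p \<in> hyperboloid \<kappa>"
  shows "norm (fst p) < snd p"
proof (rule power2_less_imp_less)
  have "(norm (fst p))\<^sup>2 - (snd p)\<^sup>2 = - 1 / \<kappa>"
    using hyperboloidD(1)[OF assms(2)] by (simp add: lorentz_self)
  moreover have "- 1 / \<kappa> < 0" using assms(1) by simp
  ultimately show "(norm (fst p))\<^sup>2 < (snd p)\<^sup>2" by linarith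
qed (use hyperboloidD(2)[OF assms(2)] in simp)

text \<open>Tangency expresses \<open>snd v\<close> through \<open>fst p \<bullet> fst v\<close>.
  Since \<open>p\<close> lies strictly inside the light cone, Cauchy-Schwarz in the spatial
  coordinates then makes \<open>v\<close> spacelike.\<close>

lemma lorentz_tangent_pos:
  assumes "\<kappa> > 0" "p \<in> hyperboloid \<kappa>" "v \<in> tangent p" "v \<noteq> 0"
  shows "lorentz v v > 0"
proof -
  have eq: "fst p \<bullet> fst v = snd p * snd v"
    using assms(3) by (simp add: tangent_def lorentz_def)
  have lt: "norm (fst p) < snd p" by (rule norm_fst_less_snd[OF assms(1,2)])
  have pos: "snd p > 0" using hyperboloidD(2)[OF assms(2)] .
  have fne: "fst v \<noteq> 0"
  proof
    assume "fst v = 0"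
    then have "snd v = 0" using eq pos by simp
    with \<open>fst v = 0\<close> assms(4) show False by (simp add: prod_eq_iff)
  qed
  have "snd p * \<bar>snd v\<bar> = \<bar>fst p \<bullet> fst v\<bar>" using eq pos by (simp add: abs_mult)
  also have "\<dots> \<le> norm (fst p) * norm (fst v)" by (rule Cauchy_Schwarz_ineq2)
  also have "\<dots> < snd p * norm (fst v)" using lt fne by simp
  finally have "\<bar>snd v\<bar> < norm (fst v)" using pos by simp
  then have "\<bar>snd v\<bar>\<^sup>2 < (norm (fst v))\<^sup>2" by (rule power_strict_mono) auto
  then show ?thesis by (simp add: lorentz_self)
qed

lemma lorentz_tangent_nonneg:
  assumes "\<kappa> > 0" "p \<in> hyperboloid \<kappa>" "v \<in> tangent p"
  shows "lorentz v v \<ge> 0"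
  using lorentz_tangent_pos[OF assms] by (cases "v = 0") (auto simp: lorentz_simps)

lemma lnorm_scaleR: "lnorm (c *\<^sub>R v) = \<bar>c\<bar> * lnorm v"
proof -
  have "lorentz (c *\<^sub>R v) (c *\<^sub>R v) = c\<^sup>2 * lorentz v v"
    by (simp add: lorentz_simps power2_eq_square)
  then show ?thesis by (simp add: lnorm_def real_sqrt_mult)
qed

lemma lnorm_tangent:
  assumes "\<kappa> > 0" "p \<in> hyperboloid \<kappa>" "v \<in> tangent p"
  shows "lnorm v \<ge> 0" "(lnorm v)\<^sup>2 = lorentz v v" "v \<noteq> 0 \<Longrightarrow> lnorm v > 0"
  using lorentz_tangent_nonneg[OF assms] lorentz_tangent_pos[OF assms] by (auto simp: lnorm_def)

lemma tangent_subspace: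
  "x \<in> tangent p \<Longrightarrow> y \<in> tangent p \<Longrightarrow> x + y \<in> tangent p"
  "x \<in> tangent p \<Longrightarrow> y \<in> tangent p \<Longrightarrow> x - y \<in> tangent p"
  "x \<in> tangent p \<Longrightarrow> c *\<^sub>R x \<in> tangent p"
  by (auto simp: tangent_def lorentz_simps)

text \<open>The usual argument applies because the component of \<open>x\<close> orthogonal to
  \<open>y\<close> is again tangent at \<open>p\<close>, where the product is positive
  definite.\<close>

lemma lorentz_Cauchy_Schwarz:
  assumes "\<kappa> > 0" "p \<in> hyperboloid \<kappa>" "x \<in> tangent p" "y \<in> tangent p"
  shows "lorentz x y \<le> lnorm x * lnorm y"
proof (cases "y = 0")
  case True
  then show ?thesis by (simp add: lorentz_simps lnorm_def)
next
  case False
  then have y: "lorentz y y > 0" by (rule lorentz_tangent_pos[OF assms(1,2,4)])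
  let ?s = "lorentz x y / lorentz y y"
  have "0 \<le> lorentz (x - ?s *\<^sub>R y) (x - ?s *\<^sub>R y)"
    by (intro lorentz_tangent_nonneg[OF assms(1,2)] tangent_subspace assms)
  also have "\<dots> = lorentz x x - (lorentz x y)\<^sup>2 / lorentz y y"
    using y by (simp add: lorentz_simps lorentz_commute[of y x] field_simps power2_eq_square)
  finally have "(lorentz x y)\<^sup>2 \<le> lorentz x x * lorentz y y"
    using y by (simp add: field_simps)
  also have "\<dots> = (lnorm x * lnorm y)\<^sup>2"
    using lnorm_tangent(2)[OF assms(1,2)] assms(3,4) by (simp add: power_mult_distrib)
  finally show ?thesis
    using lnorm_tangent(1)[OF assms(1,2)] assms(3,4) by (meson mult_nonneg_nonneg power2_le_imp_le)
qed

section \<open>Distance, exponential map and logarithm\<close>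

text \<open>Reversed Cauchy-Schwarz. The vector \<open>?w\<close> is the tangential part of
  \<open>q\<close> at \<open>p\<close> and \<open>\<kappa> * lorentz ?w ?w = ?c\<^sup>2 - 1\<close>,
  so definiteness on the tangent space bounds \<open>?c\<^sup>2\<close>; the sign of
  \<open>?c\<close> comes from both points lying on the upper sheet. This places the argument of
  \<open>arcosh\<close> in its proper domain.\<close>

lemma lorentz_hyperboloid_ge_1:
  assumes "\<kappa> > 0" "p \<in> hyperboloid \<kappa>" "q \<in> hyperboloid \<kappa>"
  shows "- \<kappa> * lorentz p q \<ge> 1" and "q \<noteq> p \<Longrightarrow> - \<kappa> * lorentz p q > 1"
proof -
  let ?c = "- \<kappa> * lorentz p q"
  let ?w = "q + (\<kappa> * lorentz p q) *\<^sub>R p"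
  note pp = hyperboloidD(1)[OF assms(2)] and qq = hyperboloidD(1)[OF assms(3)]
  have wt: "?w \<in> tangent p"
    using assms(1) pp by (simp add: tangent_def lorentz_simps)
  have ww: "\<kappa> * lorentz ?w ?w = ?c\<^sup>2 - 1"
    using assms(1) unfolding lorentz_simps pp qq lorentz_commute[of q p]
    by (simp add: field_simps power2_eq_square)
  have "fst p \<bullet> fst q \<le> norm (fst p) * norm (fst q)" by (rule norm_cauchy_schwarz)
  also have "\<dots> < snd p * snd q"
    using norm_fst_less_snd[OF assms(1,2)] norm_fst_less_snd[OF assms(1,3)]
    by (intro mult_strict_mono') auto
  finally have c0: "?c > 0" using assms(1) by (simp add: lorentz_def mult_less_0_iff)
  have "?c\<^sup>2 - 1 \<ge> 0"
    using lorentz_tangent_nonneg[OF assms(1,2) wt] assms(1) unfolding ww[symmetric] by simp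
  then have "1\<^sup>2 \<le> ?c\<^sup>2" by simp
  then show 1: "?c \<ge> 1" using c0 by (rule power2_le_imp_le[OF _ less_imp_le])
  assume "q \<noteq> p"
  have "?c \<noteq> 1"
  proof
    assume "?c = 1"
    then have "?w = q - p" "\<kappa> * lorentz ?w ?w = 0" using ww by (auto simp: algebra_simps)
    then show False
      using \<open>q \<noteq> p\<close> lorentz_tangent_pos[OF assms(1,2) wt] assms(1) by auto
  qed
  then show "?c > 1" using 1 by simp
qed

lemma hyp_dist_eq:
  assumes "\<kappa> > 0" "p \<in> hyperboloid \<kappa>" "q \<in> hyperboloid \<kappa>"
  shows "hyp_dist \<kappa> p q \<ge> 0" "cosh (sqrt \<kappa> * hyp_dist \<kappa> p q) = - \<kappa> * lorentz p q"
    and "q \<noteq> p \<Longrightarrow> hyp_dist \<kappa> p q > 0"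
  using lorentz_hyperboloid_ge_1[OF assms] assms(1)
  by (auto simp: hyp_dist_def cosh_arcosh_real arcosh_eq_0_iff_real order.strict_iff_order[of 0 "arcosh _"])

lemma hyp_dist_self: "\<kappa> > 0 \<Longrightarrow> p \<in> hyperboloid \<kappa> \<Longrightarrow> hyp_dist \<kappa> p p = 0"
  using hyperboloidD(1)[of p \<kappa>] by (simp add: hyp_dist_def)

lemma hyp_dist_commute: "hyp_dist \<kappa> p q = hyp_dist \<kappa> q p"
  by (simp add: hyp_dist_def lorentz_commute)

text \<open>Monotonicity of \<open>cosh\<close> turns minimizing the distance from \<open>p\<close>
  into maximizing the linear functional \<open>lorentz p\<close>, the form in which projections are
  handled below.\<close>

lemma hyp_dist_le_iff:
  assumes "\<kappa> > 0" "p \<in> hyperboloid \<kappa>" "q \<in> hyperboloid \<kappa>" "r \<in> hyperboloid \<kappa>"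
  shows "hyp_dist \<kappa> p q \<le> hyp_dist \<kappa> p r \<longleftrightarrow> lorentz p r \<le> lorentz p q"
proof -
  have "hyp_dist \<kappa> p q \<le> hyp_dist \<kappa> p r \<longleftrightarrow>
      cosh (sqrt \<kappa> * hyp_dist \<kappa> p q) \<le> cosh (sqrt \<kappa> * hyp_dist \<kappa> p r)"
    using assms(1) hyp_dist_eq(1)[OF assms(1,2)] assms(3,4)
    by (subst cosh_real_nonneg_le_iff) auto
  then show ?thesis
    using hyp_dist_eq(2)[OF assms(1,2)] assms by simp
qed

text \<open>Since \<open>cosh\<close> is even and \<open>sinh\<close> is odd, the absolute value in
  \<open>lnorm (t *\<^sub>R v)\<close> disappears. One formula smooth in \<open>t\<close> covers all
  signs of \<open>t\<close> and the special case \<open>t = 0\<close>.\<close>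

lemma hyp_exp_scaleR:
  assumes "\<kappa> > 0" "p \<in> hyperboloid \<kappa>" "v \<in> tangent p" "v \<noteq> 0"
  defines "a \<equiv> sqrt \<kappa> * lnorm v"
  shows "hyp_exp \<kappa> p (t *\<^sub>R v) = cosh (t * a) *\<^sub>R p + (sinh (t * a) / a) *\<^sub>R v"
proof (cases "t = 0")
  case True
  then show ?thesis by (simp add: hyp_exp_def)
next
  case False
  show ?thesis
  proof (cases "t > 0")
    case True
    then show ?thesis using assms(4) by (simp add: hyp_exp_def lnorm_scaleR a_def mult_ac)
  next
    case False
    with \<open>t \<noteq> 0\<close> have "\<bar>t\<bar> = - t" "t \<noteq> 0" by auto
    then show ?thesis using assms(4) by (simp add: hyp_exp_def lnorm_scaleR a_def mult_ac)
  qed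
qed

text \<open>Selects the sheet: the quadratic equation of the hyperboloid alone leaves the sign of
  the last coordinate open.\<close>

lemma snd_pos_if_timelike:
  assumes "\<kappa> > 0" "p \<in> hyperboloid \<kappa>" "lorentz q q < 0" "lorentz p q < 0"
  shows "snd q > 0"
proof (rule ccontr)
  assume q: "\<not> snd q > 0"
  have "(norm (fst q))\<^sup>2 \<le> (- snd q)\<^sup>2"
    using assms(3) by (simp add: lorentz_self)
  then have "norm (fst q) \<le> - snd q"
    by (rule power2_le_imp_le) (use q in auto)
  then have "norm (fst p) * norm (fst q) \<le> snd p * (- snd q)"
    using norm_fst_less_snd[OF assms(1,2)] hyperboloidD(2)[OF assms(2)] by (intro mult_mono) auto
  moreover have "\<bar>fst p \<bullet> fst q\<bar> \<le> norm (fst p) * norm (fst q)" by (rule Cauchy_Schwarz_ineq2)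
  ultimately have "lorentz p q \<ge> 0" unfolding lorentz_def by linarith
  with assms(4) show False by simp
qed

lemma hyp_exp_in_hyperboloid:
  assumes "\<kappa> > 0" "p \<in> hyperboloid \<kappa>" "v \<in> tangent p"
  shows "hyp_exp \<kappa> p v \<in> hyperboloid \<kappa>"
proof (cases "v = 0")
  case True
  then show ?thesis using assms(2) by (simp add: hyp_exp_def)
next
  case False
  define a where "a = sqrt \<kappa> * lnorm v"
  define c s where "c = cosh a" and "s = sinh a / a"
  define q where "q = c *\<^sub>R p + s *\<^sub>R v"
  have a: "a > 0" "\<kappa> * lorentz v v = a\<^sup>2"
    using lnorm_tangent[OF assms] False assms(1) by (auto simp: a_def power_mult_distrib)
  have q: "hyp_exp \<kappa> p v = q"
    using False by (simp add: hyp_exp_def a_def q_def c_def s_def)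
  have pv: "lorentz p v = 0" "lorentz v p = 0"
    using assms(3) by (auto simp: tangent_def lorentz_commute[of v p])
  have pp: "\<kappa> * lorentz p p = - 1"
    using assms(1) hyperboloidD(1)[OF assms(2)] by simp
  have "\<kappa> * lorentz q q = c\<^sup>2 * (\<kappa> * lorentz p p) + s\<^sup>2 * (\<kappa> * lorentz v v)"
    by (simp add: q_def lorentz_simps pv algebra_simps power2_eq_square)
  also have "\<dots> = - c\<^sup>2 + (sinh a)\<^sup>2"
    unfolding pp a(2) using a(1) by (simp add: s_def power_divide)
  also have "\<dots> = -1" by (simp add: c_def cosh_square_eq)
  finally have qq: "\<kappa> * lorentz q q = -1" .
  have "\<kappa> * lorentz p q = c * (\<kappa> * lorentz p p)"
    by (simp add: q_def lorentz_simps pv)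
  then have "\<kappa> * lorentz p q < 0" using pp by (simp add: c_def)
  moreover have "\<kappa> * lorentz q q < 0" using qq by simp
  ultimately have "lorentz q q < 0" "lorentz p q < 0"
    using assms(1) by (simp_all add: mult_less_0_iff)
  then have "snd q > 0" by (rule snd_pos_if_timelike[OF assms(1,2)])
  moreover have "lorentz q q = - 1 / \<kappa>"
    using qq assms(1) by (subst eq_divide_eq) (simp add: mult.commute)
  ultimately show ?thesis unfolding q hyperboloid_def by simp
qed

lemma hyp_log_props:
  assumes "\<kappa> > 0" "p \<in> hyperboloid \<kappa>" "q \<in> hyperboloid \<kappa>"
  shows "hyp_log \<kappa> p q \<in> tangent p" "lnorm (hyp_log \<kappa> p q) = hyp_dist \<kappa> p q"
    and "hyp_exp \<kappa> p (hyp_log \<kappa> p q) = q" "q \<noteq> p \<Longrightarrow> hyp_log \<kappa> p q \<noteq> 0"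
proof -
  let ?v = "hyp_log \<kappa> p q" and ?d = "hyp_dist \<kappa> p q"
  let ?w = "q + (\<kappa> * lorentz p q) *\<^sub>R p"
  let ?a = "sqrt \<kappa> * hyp_dist \<kappa> p q"
  note pp = hyperboloidD(1)[OF assms(2)] and qq = hyperboloidD(1)[OF assms(3)]
  have wt: "?w \<in> tangent p"
    using assms(1) pp by (simp add: tangent_def lorentz_simps)
  then show vt: "?v \<in> tangent p"
    by (auto simp: hyp_log_def intro!: tangent_subspace) (simp add: tangent_def lorentz_simps)
  have main: "lnorm ?v = ?d \<and> hyp_exp \<kappa> p ?v = q \<and> ?v \<noteq> 0" if "q \<noteq> p"
  proof -
    have d: "?d > 0" using hyp_dist_eq(3)[OF assms] that .
    have ww: "\<kappa> * lorentz ?w ?w = (cosh ?a)\<^sup>2 - 1"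
      using assms(1) unfolding lorentz_simps pp qq lorentz_commute[of q p] hyp_dist_eq(2)[OF assms]
      by (simp add: field_simps power2_eq_square)
    have a: "?a > 0" using d assms(1) by simp
    \<comment> \<open>This identity makes the normalization in \<open>hyp_log\<close> cancel the
      factor \<open>sinh ?a / ?a\<close> in \<open>hyp_exp\<close>.\<close>
    have wl: "sqrt \<kappa> * lnorm ?w = sinh ?a"
    proof -
      have "sqrt \<kappa> * lnorm ?w = sqrt ((cosh ?a)\<^sup>2 - 1)"
        unfolding lnorm_def ww[symmetric] by (simp add: real_sqrt_mult)
      also have "\<dots> = sinh ?a" using a by (simp add: cosh_square_eq)
      finally show ?thesis .
    qed
    then have w0: "lnorm ?w > 0" using a assms(1)
      by (metis real_sqrt_gt_zero sinh_real_pos_iff zero_less_mult_pos)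
    have v: "?v = (?d / lnorm ?w) *\<^sub>R ?w" using that by (simp add: hyp_log_def)
    have "lnorm ?v = \<bar>?d / lnorm ?w\<bar> * lnorm ?w"
      unfolding v by (rule lnorm_scaleR)
    then have lv: "lnorm ?v = ?d" using w0 d by simp
    then have v0: "?v \<noteq> 0" using d by (auto simp: lnorm_def lorentz_simps)
    have "(sinh ?a / ?a) *\<^sub>R ?v = (sinh ?a / ?a * (?d / lnorm ?w)) *\<^sub>R ?w"
      by (simp only: v scaleR_scaleR)
    also have "sinh ?a / ?a * (?d / lnorm ?w) = 1"
      using d assms(1) w0 unfolding wl[symmetric] by simp
    finally have "hyp_exp \<kappa> p ?v = cosh ?a *\<^sub>R p + ?w"
      using v0 by (simp add: hyp_exp_def lv)
    also have "\<dots> = q" by (simp add: hyp_dist_eq[OF assms])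
    finally show ?thesis using lv v0 by simp
  qed
  show "lnorm ?v = ?d"
    using main hyp_dist_self[OF assms(1,2)] by (cases "q = p") (auto simp: hyp_log_def lnorm_def lorentz_simps)
  show "hyp_exp \<kappa> p ?v = q"
    using main by (cases "q = p") (auto simp: hyp_log_def hyp_exp_def)
  show "q \<noteq> p \<Longrightarrow> ?v \<noteq> 0" using main by blast
qed

lemma hyp_geodesic_eq:
  assumes "\<kappa> > 0" "p \<in> hyperboloid \<kappa>" "q \<in> hyperboloid \<kappa>" "q \<noteq> p"
  defines "a \<equiv> sqrt \<kappa> * hyp_dist \<kappa> p q"
  shows "hyp_geodesic \<kappa> p q t = cosh (t * a) *\<^sub>R p + (sinh (t * a) / a) *\<^sub>R hyp_log \<kappa> p q"
  using hyp_exp_scaleR[OF assms(1,2)] hyp_log_props[OF assms(1,2,3)] assms(4)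
  by (simp add: hyp_geodesic_def a_def)

lemma hyp_geodesic_in_hyperboloid:
  assumes "\<kappa> > 0" "p \<in> hyperboloid \<kappa>" "q \<in> hyperboloid \<kappa>"
  shows "hyp_geodesic \<kappa> p q t \<in> hyperboloid \<kappa>"
  unfolding hyp_geodesic_def
  by (intro hyp_exp_in_hyperboloid tangent_subspace hyp_log_props assms)

lemma hyp_convex_geodesic:
  assumes "hyp_convex \<kappa> C" "p \<in> C" "q \<in> C" "0 \<le> t" "t \<le> 1"
  shows "hyp_geodesic \<kappa> p q t \<in> C"
  using assms unfolding hyp_convex_def by (meson atLeastAtMost_iff image_subset_iff)

section \<open>Geodesic velocities and the Riemannian gradient\<close>

lemma hyp_exp_line_derivative:
  assumes "\<kappa> > 0" "p \<in> hyperboloid \<kappa>" "v \<in> tangent p" "v \<noteq> 0"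
  defines "a \<equiv> sqrt \<kappa> * lnorm v"
  shows "((\<lambda>t. hyp_exp \<kappa> p (t *\<^sub>R v)) has_vector_derivative
    ((a * sinh (t * a)) *\<^sub>R p + cosh (t * a) *\<^sub>R v)) (at t)"
    and "(a * sinh (t * a)) *\<^sub>R p + cosh (t * a) *\<^sub>R v \<in> tangent (hyp_exp \<kappa> p (t *\<^sub>R v))"
proof -
  have a: "a > 0" "\<kappa> * lorentz v v = a\<^sup>2"
    using lnorm_tangent[OF assms(1-3)] assms(1,4) by (auto simp: a_def power_mult_distrib)
  have eq: "hyp_exp \<kappa> p (t *\<^sub>R v) = cosh (t * a) *\<^sub>R p + (sinh (t * a) / a) *\<^sub>R v" for t
    using hyp_exp_scaleR[OF assms(1-4)] by (simp add: a_def)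
  show "((\<lambda>t. hyp_exp \<kappa> p (t *\<^sub>R v)) has_vector_derivative
    ((a * sinh (t * a)) *\<^sub>R p + cosh (t * a) *\<^sub>R v)) (at t)"
    unfolding eq using a
    by (auto intro!: derivative_eq_intros simp: has_vector_derivative_def algebra_simps)
  have pv: "lorentz p v = 0" using assms(3) by (simp add: tangent_def)
  have "\<kappa> * lorentz (cosh (t * a) *\<^sub>R p + (sinh (t * a) / a) *\<^sub>R v)
      ((a * sinh (t * a)) *\<^sub>R p + cosh (t * a) *\<^sub>R v)
    = cosh (t * a) * a * sinh (t * a) * (\<kappa> * lorentz p p)
      + sinh (t * a) / a * cosh (t * a) * (\<kappa> * lorentz v v)"
    by (simp add: lorentz_simps pv lorentz_commute[of v p] algebra_simps)
  also have "\<dots> = 0"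
    using a assms(1) hyperboloidD(1)[OF assms(2)] by (simp add: power2_eq_square)
  finally show "(a * sinh (t * a)) *\<^sub>R p + cosh (t * a) *\<^sub>R v \<in> tangent (hyp_exp \<kappa> p (t *\<^sub>R v))"
    using assms(1) by (simp add: eq tangent_def)
qed

text \<open>The chain rule needs \<open>f\<close> to be differentiable only within the range of
  \<open>c\<close>, which lies in the hyperboloid; the result is nevertheless an unrestricted
  derivative in the curve parameter.\<close>

lemma derivative_along_hyperboloid_curve:
  assumes f: "(f has_derivative D) (at (c t) within hyperboloid \<kappa>)"
    and c: "(c has_vector_derivative v) (at t)" and "\<And>s. c s \<in> hyperboloid \<kappa>"
  shows "((\<lambda>s. f (c s)) has_real_derivative D v) (at t)"
proof -
  have "(f has_derivative D) (at (c t) within range c)"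
    using f by (rule has_derivative_subset) (use assms(3) in auto)
  from diff_chain_within[OF c[unfolded has_vector_derivative_def] this]
  have "((\<lambda>s. f (c s)) has_derivative (\<lambda>x. D (x *\<^sub>R v))) (at t)"
    by (simp add: o_def)
  moreover have "D (x *\<^sub>R v) = x * D v" for x
    using has_derivative_linear[OF f] by (simp add: linear_cmul)
  ultimately show ?thesis by (simp add: has_field_derivative_def mult_commute_abs)
qed

text \<open>The ambient derivatives belonging to \<open>g\<close> and \<open>h\<close> may differ
  off the tangent space, so both are tested along the geodesic with initial velocity
  \<open>g - h\<close>. There they must agree, and definiteness forces
  \<open>g - h = 0\<close>.\<close>

lemma has_hyp_grad_unique:
  assumes "\<kappa> > 0" "p \<in> hyperboloid \<kappa>" "has_hyp_grad \<kappa> f p g" "has_hyp_grad \<kappa> f p h"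
  shows "g = h"
proof (rule ccontr)
  assume "g \<noteq> h"
  define v where "v = g - h"
  have v: "v \<noteq> 0" "v \<in> tangent p"
    using \<open>g \<noteq> h\<close> assms(3,4) by (auto simp: v_def has_hyp_grad_def intro: tangent_subspace)
  let ?c = "\<lambda>t. hyp_exp \<kappa> p (t *\<^sub>R v)"
  have c0: "?c 0 = p" by (simp add: hyp_exp_def)
  have c': "(?c has_vector_derivative v) (at 0)"
    using hyp_exp_line_derivative(1)[OF assms(1,2) v(2,1), of 0] by simp
  have cH: "?c s \<in> hyperboloid \<kappa>" for s
    by (intro hyp_exp_in_hyperboloid tangent_subspace assms v)
  have der: "((\<lambda>s. f (?c s)) has_real_derivative lorentz u v) (at 0)"
    if u: "has_hyp_grad \<kappa> f p u" for u
  proof -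
    obtain D where "(f has_derivative D) (at p within hyperboloid \<kappa>)"
        "\<forall>w\<in>tangent p. D w = lorentz u w"
      using u unfolding has_hyp_grad_def by blast
    then show ?thesis
      using derivative_along_hyperboloid_curve[of f D ?c 0 \<kappa> v] c0 c' cH v(2) by simp
  qed
  have "lorentz g v = lorentz h v"
    using DERIV_unique[OF der[OF assms(3)] der[OF assms(4)]] .
  then have "lorentz v v = 0" by (simp add: v_def lorentz_simps)
  then show False using lorentz_tangent_pos[OF assms(1,2) v(2,1)] by simp
qed

text \<open>Riesz representation: \<open>d\<close> represents \<open>D\<close> for the Euclidean
  product, the sign flip in \<open>e\<close> converts it to the Lorentzian one, and adding a
  multiple of \<open>p\<close> projects onto the tangent space without changing products with
  tangent vectors.\<close>

lemma has_hyp_grad_exists: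
  assumes "\<kappa> > 0" "p \<in> hyperboloid \<kappa>" "f differentiable (at p within hyperboloid \<kappa>)"
  shows "\<exists>g. has_hyp_grad \<kappa> f p g"
proof -
  obtain D where D: "(f has_derivative D) (at p within hyperboloid \<kappa>)"
    using assms(3) by (auto simp: differentiable_def)
  define d where "d = adjoint D 1"
  have Dd: "D v = v \<bullet> d" for v
    using adjoint_works[OF has_derivative_linear[OF D], of v 1] by (simp add: d_def)
  define e where "e = (fst d, - snd d)"
  define g where "g = e + (\<kappa> * lorentz p e) *\<^sub>R p"
  have "g \<in> tangent p"
    using hyperboloidD(1)[OF assms(2)] assms(1) by (simp add: g_def tangent_def lorentz_simps)
  moreover have "D v = lorentz g v" if "v \<in> tangent p" for v
  proof -
    have "lorentz e v = v \<bullet> d"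
      by (simp add: lorentz_def e_def inner_prod_def inner_commute mult.commute)
    then show ?thesis using that by (simp add: Dd g_def lorentz_simps tangent_def)
  qed
  ultimately show ?thesis using D unfolding has_hyp_grad_def by blast
qed

lemma has_hyp_grad_hyp_grad:
  assumes "\<kappa> > 0" "p \<in> hyperboloid \<kappa>" "f differentiable (at p within hyperboloid \<kappa>)"
  shows "has_hyp_grad \<kappa> f p (hyp_grad \<kappa> f p)"
  unfolding hyp_grad_def
  using has_hyp_grad_exists[OF assms] has_hyp_grad_unique[OF assms(1,2)] by (metis theI)

section \<open>Parallel transport and the descent inequality\<close>

lemma hyp_transport_tangent:
  assumes "\<kappa> > 0" "p \<in> hyperboloid \<kappa>" "q \<in> hyperboloid \<kappa>" "v \<in> tangent p"
  shows "hyp_transport \<kappa> p q v \<in> tangent q"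
proof -
  have "- \<kappa> * lorentz p q \<ge> 1" by (rule lorentz_hyperboloid_ge_1[OF assms(1-3)])
  then have "\<kappa> * lorentz p q - 1 \<noteq> 0" by simp
  moreover have "lorentz q p + lorentz q q = (\<kappa> * lorentz p q - 1) / \<kappa>"
    using assms(1) hyperboloidD(1)[OF assms(3)] by (simp add: lorentz_commute[of q p] field_simps)
  ultimately show ?thesis
    using assms(1) by (simp add: tangent_def hyp_transport_def lorentz_simps)
qed

lemma hyp_transport_isometry:
  assumes "\<kappa> > 0" "p \<in> hyperboloid \<kappa>" "q \<in> hyperboloid \<kappa>" "u \<in> tangent p" "v \<in> tangent p"
  shows "lorentz (hyp_transport \<kappa> p q u) (hyp_transport \<kappa> p q v) = lorentz u v"
proof -
  define K where "K = \<kappa> * lorentz p q - 1"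
  have "- \<kappa> * lorentz p q \<ge> 1" by (rule lorentz_hyperboloid_ge_1[OF assms(1-3)])
  then have K: "K \<noteq> 0" by (simp add: K_def)
  have pu: "lorentz u p = 0" "lorentz p v = 0"
    using assms(4,5) by (auto simp: tangent_def lorentz_commute[of u p])
  \<comment> \<open>With this value the quadratic term in the expansion below cancels the two cross
    terms.\<close>
  have s: "lorentz (p + q) (p + q) = 2 * K / \<kappa>"
    using assms(1) hyperboloidD(1)[OF assms(2)] hyperboloidD(1)[OF assms(3)]
    by (simp add: lorentz_simps lorentz_commute[of q p] K_def field_simps)
  have "lorentz (hyp_transport \<kappa> p q u) (hyp_transport \<kappa> p q v) =
     lorentz u v - \<kappa> * lorentz q v / K * lorentz u (p + q) - \<kappa> * lorentz q u / K * lorentz (p + q) v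
       + \<kappa> * lorentz q u / K * (\<kappa> * lorentz q v / K) * lorentz (p + q) (p + q)"
    unfolding hyp_transport_def K_def[symmetric] lorentz_simps(3-6)
    by (simp add: algebra_simps)
  also have "\<dots> = lorentz u v"
    unfolding s using K assms(1) pu
    by (simp add: lorentz_simps lorentz_commute[of u q] field_simps)
  finally show ?thesis .
qed

text \<open>A geodesic transports its own velocity: the right-hand side is the derivative in
  \<open>hyp_exp_line_derivative\<close>. This lets the Lipschitz condition, stated through
  transport, control the slope of \<open>f\<close> along the geodesic.\<close>

lemma hyp_transport_along_exp:
  assumes "\<kappa> > 0" "p \<in> hyperboloid \<kappa>" "v \<in> tangent p" "v \<noteq> 0"
  defines "a \<equiv> sqrt \<kappa> * lnorm v"
  shows "hyp_transport \<kappa> p (hyp_exp \<kappa> p (t *\<^sub>R v)) v = (a * sinh (t * a)) *\<^sub>R p + cosh (t * a) *\<^sub>R v"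
proof -
  let ?q = "hyp_exp \<kappa> p (t *\<^sub>R v)"
  have a: "a > 0" "\<kappa> * lorentz v v = a\<^sup>2"
    using lnorm_tangent[OF assms(1-3)] assms(1,4) by (auto simp: a_def power_mult_distrib)
  have q: "?q = cosh (t * a) *\<^sub>R p + (sinh (t * a) / a) *\<^sub>R v"
    using hyp_exp_scaleR[OF assms(1-4)] by (simp add: a_def)
  have pv: "lorentz p v = 0" using assms(3) by (simp add: tangent_def)
  have qv: "\<kappa> * lorentz ?q v = a * sinh (t * a)"
  proof -
    have "\<kappa> * lorentz ?q v = sinh (t * a) / a * (\<kappa> * lorentz v v)"
      by (simp add: q lorentz_simps pv)
    then show ?thesis using a by (simp add: power2_eq_square)
  qed
  have pq: "\<kappa> * lorentz p ?q = - cosh (t * a)"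
    using assms(1) hyperboloidD(1)[OF assms(2)] by (simp add: q lorentz_simps pv)
  let ?S = "sinh (t * a)" and ?C = "cosh (t * a)"
  have C: "1 + ?C > 0" using cosh_real_pos[of "t * a"] by linarith
  have "hyp_transport \<kappa> p ?q v = v + (a * ?S / (1 + ?C)) *\<^sub>R (p + ?q)"
    unfolding hyp_transport_def qv pq using C
    by (simp add: minus_divide_right flip: scaleR_minus_left)
  also have "p + ?q = (1 + ?C) *\<^sub>R p + (?S / a) *\<^sub>R v" by (simp add: q algebra_simps)
  also have "(a * ?S / (1 + ?C)) *\<^sub>R \<dots> = (a * ?S) *\<^sub>R p + (?S\<^sup>2 / (1 + ?C)) *\<^sub>R v"
    using a C by (simp add: scaleR_right_distrib power2_eq_square)
  \<comment> \<open>Here \<open>sinh\<^sup>2 = (cosh - 1) * (cosh + 1)\<close>; adding the original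
    \<open>v\<close> leaves the coefficient \<open>?C\<close>.\<close>
  also have "?S\<^sup>2 / (1 + ?C) = ?C - 1"
    using C by (simp add: sinh_square_eq divide_eq_eq) (simp add: algebra_simps power2_eq_square)
  finally show ?thesis by (simp add: algebra_simps)
qed

lemma hyp_dist_geodesic:
  assumes "\<kappa> > 0" "p \<in> hyperboloid \<kappa>" "q \<in> hyperboloid \<kappa>" "t \<ge> 0"
  shows "hyp_dist \<kappa> p (hyp_geodesic \<kappa> p q t) = t * hyp_dist \<kappa> p q"
proof (cases "q = p")
  case True
  then show ?thesis
    using hyp_dist_self[OF assms(1,2)] by (simp add: hyp_geodesic_def hyp_log_def hyp_exp_def)
next
  case False
  let ?a = "sqrt \<kappa> * hyp_dist \<kappa> p q"
  have "- \<kappa> * lorentz p (hyp_geodesic \<kappa> p q t) = cosh (t * ?a)"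
    using hyp_log_props(1)[OF assms(1-3)] assms(1) hyperboloidD(1)[OF assms(2)]
    by (simp add: hyp_geodesic_eq[OF assms(1-3) False] lorentz_simps tangent_def)
  moreover have "t * ?a \<ge> 0" using assms hyp_dist_eq(1)[OF assms(1-3)] by simp
  ultimately show ?thesis
    unfolding hyp_dist_def[of \<kappa> p "hyp_geodesic \<kappa> p q t"] using assms(1) by (simp add: arcosh_cosh_real)
qed

text \<open>Transport is an isometry and preserves geodesic velocity, so the slope of
  \<open>f\<close> at parameter \<open>s\<close> exceeds the initial slope by at most
  \<open>L * s * d\<^sup>2\<close>. Comparing \<open>f\<close> with its quadratic model through the
  sign of a derivative avoids integration and any continuity of the gradient off
  \<open>C\<close>.\<close>

lemma hyp_descent:
  assumes \<kappa>: "\<kappa> > 0" and C: "hyp_convex \<kappa> C" and f: "f differentiable_on hyperboloid \<kappa>"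
    and L: "L \<ge> 0" "hyp_grad_lipschitz_on \<kappa> L C f"
    and pq: "p \<in> C" "q \<in> C" and t: "0 \<le> t" "t \<le> 1"
  shows "f (hyp_geodesic \<kappa> p q t) \<le> f p + t * lorentz (hyp_grad \<kappa> f p) (hyp_log \<kappa> p q)
    + L / 2 * t\<^sup>2 * (hyp_dist \<kappa> p q)\<^sup>2"
proof (cases "q = p")
  case True
  then show ?thesis using L by (simp add: hyp_geodesic_def hyp_log_def hyp_exp_def lorentz_simps)
next
  case False
  have H: "p \<in> hyperboloid \<kappa>" "q \<in> hyperboloid \<kappa>" using C pq by (auto simp: hyp_convex_def)
  define v where "v = hyp_log \<kappa> p q"
  define d where "d = hyp_dist \<kappa> p q"
  define g where "g = hyp_grad \<kappa> f p"
  let ?\<gamma> = "hyp_geodesic \<kappa> p q"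
  have v: "v \<in> tangent p" "v \<noteq> 0" "lnorm v = d"
    using hyp_log_props[OF \<kappa> H] False by (auto simp: v_def d_def)
  have grad: "has_hyp_grad \<kappa> f x (hyp_grad \<kappa> f x)" if "x \<in> hyperboloid \<kappa>" for x
    using has_hyp_grad_hyp_grad[OF \<kappa> that] f that by (auto simp: differentiable_on_def)
  have gt: "g \<in> tangent p" using grad[OF H(1)] by (simp add: g_def has_hyp_grad_def)
  have der: "((\<lambda>s. f (?\<gamma> s)) has_real_derivative
      lorentz (hyp_grad \<kappa> f (?\<gamma> s)) (hyp_transport \<kappa> p (?\<gamma> s) v)) (at s)" for s
  proof -
    have \<gamma>H: "?\<gamma> s \<in> hyperboloid \<kappa>" for s by (rule hyp_geodesic_in_hyperboloid[OF \<kappa> H])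
    have "(?\<gamma> has_vector_derivative hyp_transport \<kappa> p (?\<gamma> s) v) (at s)"
      using hyp_exp_line_derivative(1)[OF \<kappa> H(1) v(1,2)] hyp_transport_along_exp[OF \<kappa> H(1) v(1,2)]
      by (simp add: hyp_geodesic_def[abs_def] v_def)
    moreover obtain D where "(f has_derivative D) (at (?\<gamma> s) within hyperboloid \<kappa>)"
        "\<forall>w\<in>tangent (?\<gamma> s). D w = lorentz (hyp_grad \<kappa> f (?\<gamma> s)) w"
      using grad[OF \<gamma>H] unfolding has_hyp_grad_def by blast
    moreover have "hyp_transport \<kappa> p (?\<gamma> s) v \<in> tangent (?\<gamma> s)"
      by (rule hyp_transport_tangent[OF \<kappa> H(1) \<gamma>H v(1)])
    ultimately show ?thesis
      using derivative_along_hyperboloid_curve[of f D ?\<gamma> s \<kappa>] \<gamma>H by metis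
  qed
  have bound: "lorentz (hyp_grad \<kappa> f (?\<gamma> s)) (hyp_transport \<kappa> p (?\<gamma> s) v) \<le> lorentz g v + L * s * d\<^sup>2"
    if s: "0 \<le> s" "s \<le> 1" for s
  proof -
    let ?x = "?\<gamma> s" and ?T = "hyp_transport \<kappa> p (?\<gamma> s)"
    have x: "?x \<in> C" by (rule hyp_convex_geodesic[OF C pq s])
    have xH: "?x \<in> hyperboloid \<kappa>" by (rule hyp_geodesic_in_hyperboloid[OF \<kappa> H])
    note T = hyp_transport_tangent[OF \<kappa> H(1) xH]
    let ?e = "?T g - hyp_grad \<kappa> f ?x"
    have e: "?e \<in> tangent ?x"
      using T[OF gt] grad[OF xH] by (auto simp: has_hyp_grad_def intro: tangent_subspace)
    have nTv: "lnorm (?T v) = d"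
      using hyp_transport_isometry[OF \<kappa> H(1) xH v(1) v(1)] v(3) by (simp add: lnorm_def)
    \<comment> \<open>The factor \<open>- 1\<close> reverses the difference: the Lipschitz condition
      bounds \<open>?T g\<close> minus the gradient at \<open>?x\<close>, while the slope excess
      involves the opposite order.\<close>
    have "lorentz (- 1 *\<^sub>R ?e) (?T v) \<le> lnorm (- 1 *\<^sub>R ?e) * lnorm (?T v)"
      by (rule lorentz_Cauchy_Schwarz[OF \<kappa> xH tangent_subspace(3)[OF e] T[OF v(1)]])
    also have "lnorm (- 1 *\<^sub>R ?e) = lnorm ?e" by (subst lnorm_scaleR) simp
    also have "\<dots> * lnorm (?T v) \<le> L * hyp_dist \<kappa> p ?x * lnorm (?T v)"
      using L(2) pq(1) x v(3) lnorm_tangent(1)[OF \<kappa> H(1) v(1)]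
      by (intro mult_right_mono) (auto simp: hyp_grad_lipschitz_on_def g_def nTv)
    also have "\<dots> = L * s * d\<^sup>2"
      by (simp add: hyp_dist_geodesic[OF \<kappa> H s(1)] nTv power2_eq_square d_def)
    also have "lorentz (- 1 *\<^sub>R ?e) (?T v) = lorentz (hyp_grad \<kappa> f ?x) (?T v) - lorentz g v"
      using hyp_transport_isometry[OF \<kappa> H(1) xH gt v(1)] by (simp only: lorentz_simps) simp
    finally show ?thesis by linarith
  qed
  let ?h = "\<lambda>s. f (?\<gamma> s) - s * lorentz g v - L / 2 * s\<^sup>2 * d\<^sup>2"
  have "?h t \<le> ?h 0"
  proof (rule DERIV_nonpos_imp_nonincreasing[OF t(1), of ?h])
    fix s assume s: "0 \<le> s" "s \<le> t"
    have "(?h has_real_derivative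
        lorentz (hyp_grad \<kappa> f (?\<gamma> s)) (hyp_transport \<kappa> p (?\<gamma> s) v) - lorentz g v - L * s * d\<^sup>2) (at s)"
      by (auto intro!: derivative_eq_intros der)
    moreover have "lorentz (hyp_grad \<kappa> f (?\<gamma> s)) (hyp_transport \<kappa> p (?\<gamma> s) v) - lorentz g v - L * s * d\<^sup>2 \<le> 0"
      using bound[of s] s t by simp
    ultimately show "\<exists>y. DERIV ?h s :> y \<and> y \<le> 0" by blast
  qed
  moreover have "?\<gamma> 0 = p" by (simp add: hyp_geodesic_def hyp_exp_def)
  ultimately show ?thesis by (simp add: g_def v_def d_def)
qed

section \<open>Projection onto closed convex sets\<close>

text \<open>The strict condition on the last coordinate may be relaxed, as no point with
  \<open>snd p = 0\<close> satisfies the equation. Relative closedness of \<open>C\<close> thus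
  becomes closedness in the ambient space, as compactness arguments require.\<close>

lemma closed_hyperboloid:
  assumes "\<kappa> > 0"
  shows "closed (hyperboloid \<kappa> :: ((real ^ 'n) \<times> real) set)"
proof -
  have "hyperboloid \<kappa> = {p :: (real ^ 'n) \<times> real. lorentz p p = - 1 / \<kappa>} \<inter> {p. 0 \<le> snd p}"
  proof -
    have "snd p \<noteq> 0" if "lorentz p p = - 1 / \<kappa>" for p :: "(real ^ 'n) \<times> real"
    proof
      assume "snd p = 0"
      then have "lorentz p p \<ge> 0" by (simp add: lorentz_def)
      with that assms show False by (simp add: zero_le_divide_iff)
    qed
    then show ?thesis unfolding hyperboloid_def by force
  qed
  then show ?thesis
    unfolding lorentz_def
    by (auto intro!: closed_Int closed_Collect_eq closed_Collect_le continuous_intros)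
qed

text \<open>Minimality of \<open>z\<close> along the geodesic towards \<open>q\<close> gives an angle of at least \<open>\<pi> / 2\<close> at \<open>z\<close>;
  this is the resulting comparison in the hyperbolic law of cosines.\<close>

lemma hyp_proj_obtuse:
  assumes \<kappa>: "\<kappa> > 0" and C: "hyp_convex \<kappa> C" and x: "x \<in> hyperboloid \<kappa>"
    and z: "is_arg_min (hyp_dist \<kappa> x) (\<lambda>q. q \<in> C) z" and q: "q \<in> C"
  shows "cosh (sqrt \<kappa> * hyp_dist \<kappa> z q) * cosh (sqrt \<kappa> * hyp_dist \<kappa> x z)
    \<le> cosh (sqrt \<kappa> * hyp_dist \<kappa> x q)"
proof (cases "q = z")
  case True
  have "z \<in> hyperboloid \<kappa>" using z C by (auto simp: is_arg_min_def hyp_convex_def)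
  then have "hyp_dist \<kappa> z z = 0" by (rule hyp_dist_self[OF \<kappa>])
  then show ?thesis using True by simp
next
  case False
  have zC: "z \<in> C" using z by (simp add: is_arg_min_def)
  have H: "z \<in> hyperboloid \<kappa>" "q \<in> hyperboloid \<kappa>" using C zC q by (auto simp: hyp_convex_def)
  define a where "a = sqrt \<kappa> * hyp_dist \<kappa> z q"
  define v where "v = hyp_log \<kappa> z q"
  let ?\<gamma> = "hyp_geodesic \<kappa> z q"
  have a: "a > 0" using hyp_dist_eq(3)[OF \<kappa> H False] \<kappa> by (simp add: a_def)
  have \<gamma>: "?\<gamma> t = cosh (t * a) *\<^sub>R z + (sinh (t * a) / a) *\<^sub>R v" for t
    using hyp_geodesic_eq[OF \<kappa> H False] by (simp add: a_def v_def)
  have min: "lorentz x (?\<gamma> t) \<le> lorentz x z" if "0 \<le> t" "t \<le> 1" for t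
  proof -
    have "?\<gamma> t \<in> C" by (rule hyp_convex_geodesic[OF C zC q that])
    then have "hyp_dist \<kappa> x z \<le> hyp_dist \<kappa> x (?\<gamma> t)"
      using z unfolding is_arg_min_def by (meson not_less)
    then show ?thesis
      using hyp_dist_le_iff[OF \<kappa> x H(1) hyp_geodesic_in_hyperboloid[OF \<kappa> H]] by simp
  qed
  have "((\<lambda>t. lorentz x (?\<gamma> t)) has_real_derivative lorentz x v) (at 0)"
    using a unfolding \<gamma> lorentz_simps by (auto intro!: derivative_eq_intros)
  have le: "lorentz x v \<le> 0"
  proof (rule ccontr)
    assume "\<not> lorentz x v \<le> 0"
    then have "0 < lorentz x v" by simp
    from has_real_derivative_pos_inc_right[OF \<open>(_ has_real_derivative lorentz x v) (at 0)\<close> this]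
    obtain e where e: "e > 0" "\<And>h. 0 < h \<Longrightarrow> h < e \<Longrightarrow> lorentz x (?\<gamma> 0) < lorentz x (?\<gamma> h)"
      by auto
    \<comment> \<open>The parameter \<open>min 1 (e / 2)\<close> is below \<open>e\<close> and stays
      on the segment, where minimality of \<open>z\<close> applies.\<close>
    have "lorentz x (?\<gamma> 0) < lorentz x (?\<gamma> (min 1 (e / 2)))" using e(1) by (intro e(2)) auto
    moreover have "lorentz x (?\<gamma> (min 1 (e / 2))) \<le> lorentz x z" using e(1) by (intro min) auto
    ultimately show False by (simp add: \<gamma>)
  qed
  have "q = ?\<gamma> 1" using hyp_log_props(3)[OF \<kappa> H] by (simp add: hyp_geodesic_def)
  then have "- \<kappa> * lorentz x q = cosh a * (- \<kappa> * lorentz x z) + (sinh a / a) * \<kappa> * (- lorentz x v)"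
    unfolding \<gamma> by (simp add: lorentz_simps algebra_simps)
  also have "\<dots> \<ge> cosh a * (- \<kappa> * lorentz x z)"
  proof -
    have "0 \<le> (sinh a / a) * \<kappa> * (- lorentz x v)"
      using a \<kappa> le by (intro mult_nonneg_nonneg) auto
    then show ?thesis by linarith
  qed
  finally show ?thesis
    unfolding hyp_dist_eq(2)[OF \<kappa> x H(2)] hyp_dist_eq(2)[OF \<kappa> x H(1)] a_def .
qed

text \<open>It suffices to maximize \<open>lorentz x\<close> on the superlevel set \<open>S\<close>
  through \<open>q0\<close>. Because \<open>x\<close> is strictly inside the light cone,
  \<open>R\<close> bounds the last coordinate on \<open>S\<close>, and on the hyperboloid that
  coordinate dominates the spatial norm, so \<open>S\<close> is compact.\<close>

lemma hyp_proj_exists: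
  assumes \<kappa>: "\<kappa> > 0" and C: "C \<subseteq> hyperboloid \<kappa>" "closed C" "C \<noteq> {}" and x: "x \<in> hyperboloid \<kappa>"
  shows "\<exists>z. is_arg_min (hyp_dist \<kappa> x) (\<lambda>q. q \<in> C) z"
proof -
  obtain q0 where q0: "q0 \<in> C" using C by blast
  define S where "S = {q \<in> C. lorentz x q0 \<le> lorentz x q}"
  define R where "R = - lorentz x q0 / (snd x - norm (fst x))"
  have cont: "continuous_on UNIV (lorentz x)" unfolding lorentz_def by (intro continuous_intros)
  have "norm q \<le> R + R" if "q \<in> S" for q
  proof -
    have qH: "q \<in> hyperboloid \<kappa>" using that C by (auto simp: S_def)
    have lt: "norm (fst q) < snd q" "norm (fst x) < snd x" by (rule norm_fst_less_snd[OF \<kappa>] qH x)+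
    have "\<bar>fst x \<bullet> fst q\<bar> \<le> norm (fst x) * norm (fst q)" by (rule Cauchy_Schwarz_ineq2)
    also have "\<dots> \<le> norm (fst x) * snd q" using lt by (intro mult_left_mono) auto
    finally have "(snd x - norm (fst x)) * snd q \<le> - lorentz x q"
      by (simp add: lorentz_def algebra_simps)
    also have "\<dots> \<le> - lorentz x q0" using that by (simp add: S_def)
    finally have "snd q \<le> R" using lt by (simp add: R_def field_simps)
    moreover have "norm q \<le> norm (fst q) + norm (snd q)"
      using norm_Pair_le[of "fst q" "snd q"] by simp
    moreover have "0 \<le> norm (fst q)" by simp
    ultimately show ?thesis using lt(1) by simp
  qed
  then have "bounded S" unfolding bounded_iff by blast
  moreover have "closed S"
    unfolding S_def Collect_conj_eq[of "\<lambda>q. q \<in> C"] using C(2) cont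
    by (intro closed_Int closed_Collect_le continuous_intros) auto
  ultimately have "compact S" by (simp add: compact_eq_bounded_closed)
  moreover have "q0 \<in> S" using q0 by (simp add: S_def)
  ultimately obtain z where z: "z \<in> S" "\<And>q. q \<in> S \<Longrightarrow> lorentz x q \<le> lorentz x z"
    using continuous_attains_sup[of S "lorentz x"] continuous_on_subset[OF cont] by blast
  have max: "lorentz x q \<le> lorentz x z" if "q \<in> C" for q
    using z(2)[of q] z(2)[OF \<open>q0 \<in> S\<close>] that by (cases "q \<in> S") (auto simp: S_def)
  have zC: "z \<in> C" using z(1) by (simp add: S_def)
  have "hyp_dist \<kappa> x z \<le> hyp_dist \<kappa> x q" if "q \<in> C" for q
    using hyp_dist_le_iff[OF \<kappa> x, of z q] max[OF that] zC that C(1) by auto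
  then show ?thesis using zC unfolding is_arg_min_def by (meson not_less)
qed

text \<open>Justifies the definite description in \<open>hyp_proj\<close>. Two minimizers are
  equally far from \<open>x\<close>, so the obtuse-angle inequality leaves
  \<open>cosh (sqrt \<kappa> * hyp_dist \<kappa> z w) \<le> 1\<close>, which excludes distinct
  points.\<close>

lemma is_arg_min_hyp_proj:
  assumes \<kappa>: "\<kappa> > 0" and C: "hyp_convex \<kappa> C" "closed C" "C \<noteq> {}" and x: "x \<in> hyperboloid \<kappa>"
  shows "is_arg_min (hyp_dist \<kappa> x) (\<lambda>q. q \<in> C) (hyp_proj \<kappa> C x)"
proof -
  have sub: "C \<subseteq> hyperboloid \<kappa>" using C(1) by (simp add: hyp_convex_def)
  obtain z where z: "is_arg_min (hyp_dist \<kappa> x) (\<lambda>q. q \<in> C) z"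
    using hyp_proj_exists[OF \<kappa> sub C(2,3) x] by blast
  have "w = z" if w: "is_arg_min (hyp_dist \<kappa> x) (\<lambda>q. q \<in> C) w" for w
  proof (rule ccontr)
    assume "w \<noteq> z"
    have zw: "z \<in> C" "w \<in> C" using z w by (auto simp: is_arg_min_def)
    then have H: "z \<in> hyperboloid \<kappa>" "w \<in> hyperboloid \<kappa>" using sub by auto
    have "hyp_dist \<kappa> x z = hyp_dist \<kappa> x w"
      using z w unfolding is_arg_min_def by (meson antisym not_less)
    then have "cosh (sqrt \<kappa> * hyp_dist \<kappa> z w) * cosh (sqrt \<kappa> * hyp_dist \<kappa> x z)
      \<le> 1 * cosh (sqrt \<kappa> * hyp_dist \<kappa> x z)"
      using hyp_proj_obtuse[OF \<kappa> C(1) x z zw(2)] by simp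
    then have "cosh (sqrt \<kappa> * hyp_dist \<kappa> z w) \<le> 1"
      by (rule mult_right_le_imp_le) simp
    moreover have "cosh (sqrt \<kappa> * hyp_dist \<kappa> z w) > 1"
      using lorentz_hyperboloid_ge_1(2)[OF \<kappa> H \<open>w \<noteq> z\<close>] hyp_dist_eq(2)[OF \<kappa> H] by simp
    ultimately show False by simp
  qed
  then show ?thesis unfolding hyp_proj_def using z by (metis theI)
qed

section \<open>The slope estimate for the projected step\<close>

text \<open>The derivative has the sign of \<open>x - sinh x * cosh x\<close>, which is nonpositive
  because \<open>x \<le> sinh x\<close> and \<open>1 \<le> cosh x\<close>. This is what converts
  hyperbolic functions of side lengths into squared lengths.\<close>

lemma tanh_over_id_antimono:
  assumes "0 < a" "a \<le> (r::real)"
  shows "tanh r / r \<le> tanh a / a"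
proof (rule DERIV_nonpos_imp_nonincreasing[OF assms(2), of "\<lambda>x. tanh x / x"])
  fix x assume x: "a \<le> x" "x \<le> r"
  then have x0: "x > 0" using assms by simp
  let ?D = "(x * (1 - (tanh x)\<^sup>2) - tanh x) / x\<^sup>2"
  have D: "((\<lambda>x. tanh x / x) has_real_derivative ?D) (at x)"
    using x0 by (auto intro!: derivative_eq_intros simp: power2_eq_square cosh_real_nonzero algebra_simps)
  have "sinh 0 - 0 \<le> sinh x - x"
  proof (rule DERIV_nonneg_imp_nondecreasing[of 0 x "\<lambda>s. sinh s - s"])
    fix s :: real
    have "((\<lambda>s. sinh s - s) has_real_derivative cosh s - 1) (at s)"
      by (auto intro!: derivative_eq_intros)
    then show "\<exists>y. ((\<lambda>s. sinh s - s) has_real_derivative y) (at s) \<and> 0 \<le> y"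
      using cosh_real_ge_1[of s] by force
  qed (use x0 in simp)
  then have "x \<le> sinh x * 1" by simp
  also have "\<dots> \<le> sinh x * cosh x" using x0 by (intro mult_left_mono) (auto simp: cosh_real_ge_1)
  finally have s: "x \<le> sinh x * cosh x" .
  have "x * (1 - (tanh x)\<^sup>2) = x / (cosh x)\<^sup>2"
  proof -
    have "(cosh x)\<^sup>2 * (1 - (tanh x)\<^sup>2) = (cosh x)\<^sup>2 - (sinh x)\<^sup>2"
      by (simp add: tanh_def power_divide right_diff_distrib)
    also have "\<dots> = 1" by (simp add: cosh_square_eq)
    finally have "1 - (tanh x)\<^sup>2 = 1 / (cosh x)\<^sup>2"
      by (simp add: eq_divide_eq mult.commute)
    then show ?thesis by simp
  qed
  also have "\<dots> \<le> sinh x * cosh x / (cosh x)\<^sup>2" using s by (intro divide_right_mono) auto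
  also have "\<dots> = tanh x" by (simp add: tanh_def power2_eq_square)
  finally have "?D \<le> 0" by (simp add: divide_nonpos_nonneg)
  with D show "\<exists>y. ((\<lambda>x. tanh x / x) has_real_derivative y) (at x) \<and> y \<le> 0" by blast
qed

text \<open>In the triangle \<open>p\<close>, \<open>z\<close>, \<open>y\<close> with scaled sides
  \<open>a\<close>, \<open>b\<close>, \<open>r\<close>, the law of cosines at \<open>p\<close> is
  \<open>cb\<close> and the angle condition at \<open>z\<close> is \<open>ob\<close>. Eliminating
  \<open>b\<close> bounds \<open>\<kappa> * lorentz w v\<close> below by
  \<open>a * r * tanh a / tanh r\<close>, and this is at least \<open>a\<^sup>2\<close> since
  \<open>a \<le> r\<close>.\<close>

lemma hyp_proj_exp_log_ge:
  assumes \<kappa>: "\<kappa> > 0" and C: "hyp_convex \<kappa> C" and p: "p \<in> C"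
    and w: "w \<in> tangent p" "w \<noteq> 0"
    and z: "is_arg_min (hyp_dist \<kappa> (hyp_exp \<kappa> p w)) (\<lambda>q. q \<in> C) z"
  shows "(hyp_dist \<kappa> p z)\<^sup>2 \<le> lorentz w (hyp_log \<kappa> p z)"
proof (cases "z = p")
  case True
  have "p \<in> hyperboloid \<kappa>" using C p by (auto simp: hyp_convex_def)
  then show ?thesis using True hyp_dist_self[OF \<kappa>] by (simp add: hyp_log_def lorentz_simps)
next
  case False
  have zC: "z \<in> C" using z by (simp add: is_arg_min_def)
  have H: "p \<in> hyperboloid \<kappa>" "z \<in> hyperboloid \<kappa>" using C p zC by (auto simp: hyp_convex_def)
  define y where "y = hyp_exp \<kappa> p w"
  define v where "v = hyp_log \<kappa> p z"
  define a where "a = sqrt \<kappa> * hyp_dist \<kappa> p z"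
  define b where "b = sqrt \<kappa> * hyp_dist \<kappa> y z"
  define r where "r = sqrt \<kappa> * lnorm w"
  have yH: "y \<in> hyperboloid \<kappa>" unfolding y_def by (rule hyp_exp_in_hyperboloid[OF \<kappa> H(1) w(1)])
  have a: "a > 0" using hyp_dist_eq(3)[OF \<kappa> H False] \<kappa> by (simp add: a_def)
  have r: "r > 0" using lnorm_tangent(3)[OF \<kappa> H(1) w] \<kappa> by (simp add: r_def)
  have y: "y = cosh r *\<^sub>R p + (sinh r / r) *\<^sub>R w" using w(2) by (simp add: y_def hyp_exp_def r_def)
  have zz: "z = cosh a *\<^sub>R p + (sinh a / a) *\<^sub>R v"
    using hyp_geodesic_eq[OF \<kappa> H False, of 1] hyp_log_props(3)[OF \<kappa> H]
    by (simp add: hyp_geodesic_def a_def v_def)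
  have pv: "lorentz p v = 0" "lorentz p w = 0"
    using hyp_log_props(1)[OF \<kappa> H] w(1) by (auto simp: tangent_def v_def)
  have pp: "\<kappa> * lorentz p p = -1" using hyperboloidD(1)[OF H(1)] \<kappa> by simp
  have yp: "- \<kappa> * lorentz y p = cosh r"
    unfolding y lorentz_simps lorentz_commute[of w p] pv using pp by (simp add: mult.left_commute[of \<kappa>])
  have "- \<kappa> * lorentz y z = cosh r * cosh a * - (\<kappa> * lorentz p p) - sinh r / r * (sinh a / a) * (\<kappa> * lorentz w v)"
    unfolding y zz using pv by (simp add: lorentz_simps lorentz_commute[of w p] algebra_simps)
  then have cb: "cosh b = cosh r * cosh a - sinh r / r * (sinh a / a) * (\<kappa> * lorentz w v)"
    using hyp_dist_eq(2)[OF \<kappa> yH H(2)] pp by (simp add: b_def)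
  have ob: "cosh a * cosh b \<le> cosh r"
    using hyp_proj_obtuse[OF \<kappa> C yH z[folded y_def] p] yp hyp_dist_eq(2)[OF \<kappa> yH H(1)]
    by (simp add: a_def b_def hyp_dist_commute[of \<kappa> z p])
  \<comment> \<open>The side opposite the obtuse or right angle is the longest, which supplies the
    ordering needed for the monotonicity of \<open>tanh x / x\<close>.\<close>
  have "cosh a * 1 \<le> cosh a * cosh b" by (intro mult_left_mono) (auto simp: cosh_real_ge_1)
  with ob have "cosh a \<le> cosh r" by linarith
  then have ar: "a \<le> r" using a r by (simp add: cosh_real_nonneg_le_iff)
  have "cosh r * (sinh a)\<^sup>2 = cosh a * (cosh r * cosh a) - cosh r"
    unfolding sinh_square_eq by (simp add: power2_eq_square algebra_simps)
  also have "\<dots> \<le> cosh a * (cosh r * cosh a - cosh b)" using ob by (simp add: algebra_simps)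
  also have "\<dots> = cosh a * (sinh r / r * (sinh a / a) * (\<kappa> * lorentz w v))" by (simp add: cb)
  finally have 1: "cosh r * sinh a * a * r \<le> cosh a * sinh r * (\<kappa> * lorentz w v)"
    using a r by (simp add: field_simps power2_eq_square)
  have "cosh a * sinh r * a\<^sup>2 \<le> cosh r * sinh a * a * r"
    using tanh_over_id_antimono[OF a ar] a r
    by (simp add: tanh_def field_simps power2_eq_square)
  with 1 have "cosh a * sinh r * a\<^sup>2 \<le> cosh a * sinh r * (\<kappa> * lorentz w v)" by linarith
  then have "a\<^sup>2 \<le> \<kappa> * lorentz w v" using r by simp
  then show ?thesis using \<kappa> by (simp add: a_def v_def power_mult_distrib)
qed

section \<open>The line search and the convergence rate\<close>

text \<open>By \<open>d\<close> and \<open>small\<close>, the quadratic term of the descent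
  inequality is at most \<open>1 - \<rho>\<close> times the linear decrease, so a fraction
  \<open>\<rho>\<close> of that decrease survives.\<close>

lemma hyp_backtracking_accepts:
  assumes \<kappa>: "\<kappa> > 0" and C: "hyp_convex \<kappa> C" and f: "f differentiable_on hyperboloid \<kappa>"
    and L: "L \<ge> 0" "hyp_grad_lipschitz_on \<kappa> L C f"
    and pq: "p \<in> C" "q \<in> C" and t: "0 \<le> t" "t \<le> 1"
    and d: "(hyp_dist \<kappa> p q)\<^sup>2 \<le> a * - lorentz (hyp_grad \<kappa> f p) (hyp_log \<kappa> p q)"
    and neg: "lorentz (hyp_grad \<kappa> f p) (hyp_log \<kappa> p q) \<le> 0"
    and small: "L * a * t \<le> 2 * (1 - \<rho>)"
  shows "f (hyp_geodesic \<kappa> p q t) \<le> f p + \<rho> * t * lorentz (hyp_grad \<kappa> f p) (hyp_log \<kappa> p q)"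
proof -
  let ?s = "lorentz (hyp_grad \<kappa> f p) (hyp_log \<kappa> p q)"
  have "L / 2 * t\<^sup>2 * (hyp_dist \<kappa> p q)\<^sup>2 \<le> L / 2 * t\<^sup>2 * (a * - ?s)"
    using d L(1) by (intro mult_left_mono) auto
  also have "\<dots> = (L * a * t) * (t * - ?s / 2)" by (simp add: power2_eq_square)
  also have "\<dots> \<le> (2 * (1 - \<rho>)) * (t * - ?s / 2)"
    using small t(1) neg by (intro mult_right_mono) (auto simp: mult_nonneg_nonpos)
  also have "\<dots> = \<rho> * t * ?s - t * ?s" by (simp add: field_simps)
  finally show ?thesis
    using hyp_descent[OF \<kappa> C f L pq t] by linarith
qed

theorem theorem23:
  fixes \<kappa> L \<rho> \<beta> \<theta>0 \<alpha>lo \<alpha>hi \<theta>bar fstar :: real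
    and C :: "((real ^ 'n) \<times> real) set"
    and f :: "(real ^ 'n) \<times> real \<Rightarrow> real"
    and \<alpha> \<theta> :: "nat \<Rightarrow> real" and l :: "nat \<Rightarrow> nat"
    and p y z :: "nat \<Rightarrow> (real ^ 'n) \<times> real"
    and N :: nat
  assumes "\<kappa> > 0"
    and "closedin (top_of_set (hyperboloid \<kappa>)) C"
    and "hyp_convex \<kappa> C"
    and "f differentiable_on hyperboloid \<kappa>"
    and "\<exists>q. is_arg_min f (\<lambda>q. q \<in> C) q"
    and "bdd_below (f ` C)"
    and "fstar = (INF q\<in>C. f q)"
    and "L \<ge> 0"
    and "hyp_grad_lipschitz_on \<kappa> L C f"
    and "0 < \<rho>" "\<rho> < 1"
    and "0 < \<beta>" "\<beta> < 1"
    and "0 < \<theta>0" "\<theta>0 < 1"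
    and "0 < \<alpha>lo" "0 < \<alpha>hi"
    and "grad_proj_backtracking_run \<kappa> C f \<rho> \<beta> \<theta>0 \<alpha>lo \<alpha>hi \<alpha> \<theta> l p y z"
    and "\<forall>k. hyp_grad \<kappa> f (p k) \<noteq> 0"
    and "\<theta>bar = (if L = 0 then \<theta>0 else min \<theta>0 (2 / (\<alpha>hi * L) * (1 - \<rho>)))"
  shows "(MIN k\<in>{0..N}. hyp_dist \<kappa> (p k) (z k))
           \<le> sqrt (\<alpha>hi * (f (p 0) - fstar)) / sqrt (\<rho> * \<beta> * \<theta>bar) * (1 / sqrt (real (N + 1)))"
proof -
  note \<kappa> = assms(1) and C = assms(3) and f = assms(4) and L = assms(8,9)
  have closed: "closed C"
    using closedin_closed_trans[OF assms(2) closed_hyperboloid[OF \<kappa>]] .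
  have p0: "p 0 \<in> C" and \<theta>0: "\<theta> 0 = \<theta>0"
    and \<alpha>: "\<alpha>lo \<le> \<alpha> k" "\<alpha> k \<le> \<alpha>hi"
    and y: "y k = hyp_exp \<kappa> (p k) (- \<alpha> k *\<^sub>R hyp_grad \<kappa> f (p k))"
    and z: "z k = hyp_proj \<kappa> C (y k)"
    and l: "l k = (LEAST j. 1 \<le> j \<and>
              f (hyp_geodesic \<kappa> (p k) (z k) (\<beta> ^ j * \<theta> k))
                \<le> f (p k) + \<rho> * \<beta> ^ j * \<theta> k
                           * lorentz (hyp_grad \<kappa> f (p k)) (hyp_log \<kappa> (p k) (z k)))"
    and pS: "p (Suc k) = hyp_geodesic \<kappa> (p k) (z k) (\<beta> ^ l k * \<theta> k)"
    and \<theta>S: "\<theta> (Suc k) = \<beta> ^ (l k - 1) * \<theta> k" for k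
    using assms(18) unfolding grad_proj_backtracking_run_def by blast+
  have \<theta>bar: "\<theta>bar > 0" "\<theta>bar \<le> \<theta>0"
    using assms by auto
  define d where "d k = hyp_dist \<kappa> (p k) (z k)" for k
  \<comment> \<open>Feasibility and the two bounds on \<open>\<theta>\<close> form the invariant of
    the iteration. The upper bound \<open>\<theta>0 < 1\<close> keeps trial points on the segment
    from \<open>p k\<close> to \<open>z k\<close>, hence in \<open>C\<close>.\<close>
  have step: "0 \<le> d k \<and> p (Suc k) \<in> C \<and> \<theta>bar \<le> \<theta> (Suc k) \<and> \<theta> (Suc k) \<le> \<theta>0 \<and>
      \<rho> * \<beta> * \<theta>bar * (d k)\<^sup>2 \<le> \<alpha>hi * (f (p k) - f (p (Suc k)))"
    if pk: "p k \<in> C" and \<theta>k: "\<theta>bar \<le> \<theta> k" "\<theta> k \<le> \<theta>0" for k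
  proof -
    let ?g = "hyp_grad \<kappa> f (p k)" and ?v = "hyp_log \<kappa> (p k) (z k)"
    define s where "s = lorentz ?g ?v"
    have pH: "p k \<in> hyperboloid \<kappa>" using pk C by (auto simp: hyp_convex_def)
    have \<alpha>0: "\<alpha> k > 0" using \<alpha>(1)[of k] assms(16) by simp
    have "has_hyp_grad \<kappa> f (p k) ?g"
      using has_hyp_grad_hyp_grad[OF \<kappa> pH] f pH by (auto simp: differentiable_on_def)
    then have g: "?g \<in> tangent (p k)" by (simp add: has_hyp_grad_def)
    let ?w = "- \<alpha> k *\<^sub>R ?g"
    have w: "?w \<in> tangent (p k)" "?w \<noteq> 0"
      by (rule tangent_subspace(3)[OF g]) (use assms(19) \<alpha>0 in simp)
    have "y k \<in> hyperboloid \<kappa>" unfolding y by (rule hyp_exp_in_hyperboloid[OF \<kappa> pH w(1)])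
    then have arg: "is_arg_min (hyp_dist \<kappa> (y k)) (\<lambda>q. q \<in> C) (z k)"
      unfolding z using pk by (intro is_arg_min_hyp_proj[OF \<kappa> C closed]) auto
    then have zC: "z k \<in> C" by (simp add: is_arg_min_def)
    have d\<alpha>: "(d k)\<^sup>2 \<le> \<alpha> k * - s"
      using hyp_proj_exp_log_ge[OF \<kappa> C pk w arg[unfolded y]] by (simp only: lorentz_simps d_def s_def)
    then have "0 \<le> \<alpha> k * - s" using zero_le_power2[of "d k"] by linarith
    then have s: "s \<le> 0" using \<alpha>0 by (simp add: mult_le_0_iff)
    \<comment> \<open>Since \<open>s \<le> 0\<close>, the varying step size can be replaced by its
      uniform bound, the source of \<open>\<alpha>hi\<close> in the rate.\<close>
    have "\<alpha> k * - s \<le> \<alpha>hi * - s" using \<alpha>(2) s by (intro mult_right_mono) auto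
    with d\<alpha> have ds: "(d k)\<^sup>2 \<le> \<alpha>hi * - s" by linarith
    have \<theta>01: "0 < \<theta> k" "\<theta> k < 1" using \<theta>k \<theta>bar assms(15) by auto
    have \<tau>: "0 < \<beta> ^ j * \<theta> k" "\<beta> ^ j * \<theta> k \<le> \<theta> k" for j
      using \<theta>01(1) assms(12,13) by (auto simp: power_le_one intro: mult_left_le_one_le)
    define P where "P j \<longleftrightarrow> 1 \<le> j \<and>
      f (hyp_geodesic \<kappa> (p k) (z k) (\<beta> ^ j * \<theta> k)) \<le> f (p k) + \<rho> * \<beta> ^ j * \<theta> k * s" for j
    have lk: "l k = (LEAST j. P j)" unfolding P_def s_def by (rule l)
    have accept: "P j" if "1 \<le> j" "L * \<alpha>hi * (\<beta> ^ j * \<theta> k) \<le> 2 * (1 - \<rho>)" for j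
      using hyp_backtracking_accepts[OF \<kappa> C f L pk zC _ _ _ _ that(2)] \<tau>[of j] \<theta>01 ds s that(1)
      by (simp add: P_def d_def s_def mult.assoc)
    \<comment> \<open>Some trial step must pass the test, since otherwise \<open>LEAST\<close>
      carries no information. The summand \<open>1\<close> keeps the denominator positive when
      \<open>L = 0\<close>.\<close>
    obtain n where n: "\<beta> ^ n < 2 * (1 - \<rho>) / (L * \<alpha>hi + 1)"
      using real_arch_pow_inv[of "2 * (1 - \<rho>) / (L * \<alpha>hi + 1)" \<beta>] assms by (auto simp: add_nonneg_pos)
    have "L * \<alpha>hi * (\<beta> ^ Suc n * \<theta> k) \<le> L * \<alpha>hi * \<beta> ^ n"
    proof (intro mult_left_mono)
      have "\<beta> ^ n * (\<beta> * \<theta> k) \<le> \<beta> ^ n"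
        using \<theta>01 assms(12,13) by (intro mult_right_le_one_le) (auto simp: mult_le_one)
      then show "\<beta> ^ Suc n * \<theta> k \<le> \<beta> ^ n" by (simp add: mult_ac)
    qed (use assms in auto)
    also have "\<dots> \<le> (L * \<alpha>hi + 1) * \<beta> ^ n" using assms(12) by (intro mult_right_mono) auto
    also have "\<dots> \<le> 2 * (1 - \<rho>)"
      using n assms(8,17) by (simp add: pos_less_divide_eq add_nonneg_pos mult.commute)
    finally have "P (Suc n)" by (intro accept) auto
    then have Pl: "P (l k)" unfolding lk by (rule LeastI)
    then have l1: "1 \<le> l k" by (simp add: P_def)
    have \<theta>ge: "\<theta>bar \<le> \<theta> (Suc k)"
    proof (cases "l k = 1")
      case True
      then show ?thesis using \<theta>k by (simp add: \<theta>S)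
    next
      case False
      \<comment> \<open>The exponent \<open>l k - 1\<close> was tried and rejected, and its step is
        exactly \<open>\<theta> (Suc k)\<close>. Rejection contradicts \<open>accept\<close> unless
        that step exceeds the threshold in \<open>\<theta>bar\<close>.\<close>
      with l1 have "l k - 1 < (LEAST j. P j)" "1 \<le> l k - 1" unfolding lk[symmetric] by auto
      from not_less_Least[OF this(1)] accept[OF this(2)]
      have gt: "2 * (1 - \<rho>) < L * \<alpha>hi * \<theta> (Suc k)"
        unfolding \<theta>S by (meson not_le)
      then have "L \<noteq> 0" using assms(11) by auto
      with assms(8) have "L > 0" by simp
      have "\<theta>bar \<le> 2 * (1 - \<rho>) / (\<alpha>hi * L)" using assms(20) \<open>L \<noteq> 0\<close> by simp
      also have "\<dots> \<le> \<theta> (Suc k)"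
        using gt \<open>L > 0\<close> assms(17) by (simp add: pos_divide_le_eq mult_ac)
      finally show ?thesis .
    qed
    \<comment> \<open>The accepted step is one factor \<open>\<beta>\<close> below
      \<open>\<theta> (Suc k)\<close>; this factor reappears in the rate.\<close>
    have "\<beta> ^ l k * \<theta> k = \<beta> * \<theta> (Suc k)"
      using l1 by (simp add: \<theta>S power_eq_if[of \<beta> "l k"])
    then have "f (p (Suc k)) \<le> f (p k) + \<rho> * \<beta> * \<theta> (Suc k) * s"
      using Pl by (simp add: P_def pS mult.assoc)
    then have "\<alpha>hi * (\<rho> * \<beta> * \<theta> (Suc k) * - s) \<le> \<alpha>hi * (f (p k) - f (p (Suc k)))"
      using assms(17) by (intro mult_left_mono) auto
    moreover have "\<rho> * \<beta> * \<theta>bar * (d k)\<^sup>2 \<le> \<rho> * \<beta> * \<theta> (Suc k) * (\<alpha>hi * - s)"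
      using \<theta>ge \<theta>bar ds assms(10,12) by (intro mult_mono) auto
    ultimately have "\<rho> * \<beta> * \<theta>bar * (d k)\<^sup>2 \<le> \<alpha>hi * (f (p k) - f (p (Suc k)))"
      by (simp add: mult_ac)
    moreover have "p (Suc k) \<in> C"
      unfolding pS
      by (rule hyp_convex_geodesic[OF C pk zC less_imp_le[OF \<tau>(1)] order_trans[OF \<tau>(2)]])
        (use \<theta>01 in simp)
    moreover have "\<theta> (Suc k) \<le> \<theta>0" using \<tau>(2)[of "l k - 1"] \<theta>k by (simp add: \<theta>S)
    moreover have "0 \<le> d k"
      unfolding d_def using zC C by (intro hyp_dist_eq(1)[OF \<kappa> pH]) (auto simp: hyp_convex_def)
    ultimately show ?thesis using \<theta>ge by blast
  qed
  have inv: "p k \<in> C \<and> \<theta>bar \<le> \<theta> k \<and> \<theta> k \<le> \<theta>0" for k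
    by (induction k) (use p0 \<theta>0 \<theta>bar step in auto)
  define c where "c = \<rho> * \<beta> * \<theta>bar"
  have c: "c > 0" using \<theta>bar assms by (simp add: c_def)
  have d0: "d k \<ge> 0" for k using step[of k] inv[of k] by blast
  define m where "m = (MIN k\<in>{0..N}. d k)"
  have m_le: "m \<le> d k" if "k \<le> N" for k
    unfolding m_def using that by (intro Min_le) auto
  have m0: "m \<ge> 0" unfolding m_def using d0 by (subst Min_ge_iff) auto
  have "(N + 1) * (c * m\<^sup>2) = (\<Sum>k\<le>N. c * m\<^sup>2)" by simp
  also have "\<dots> \<le> (\<Sum>k\<le>N. \<alpha>hi * (f (p k) - f (p (Suc k))))"
  proof (rule sum_mono)
    fix k assume "k \<in> {..N}"
    then have "c * m\<^sup>2 \<le> c * (d k)\<^sup>2"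
      using m_le[of k] m0 c by (intro mult_left_mono power_mono) auto
    also have "\<dots> \<le> \<alpha>hi * (f (p k) - f (p (Suc k)))"
      using step[of k] inv[of k] by (simp add: c_def)
    finally show "c * m\<^sup>2 \<le> \<alpha>hi * (f (p k) - f (p (Suc k)))" .
  qed
  \<comment> \<open>The decreases telescope, and \<open>p (Suc N)\<close> is feasible, so the final
    value is at least \<open>fstar\<close>.\<close>
  also have "\<dots> = \<alpha>hi * (f (p 0) - f (p (Suc N)))"
    by (simp add: sum_telescope[of "\<lambda>k. f (p k)"] flip: sum_distrib_left)
  also have "\<dots> \<le> \<alpha>hi * (f (p 0) - fstar)"
    using cINF_lower[OF assms(6), of "p (Suc N)"] inv assms(7,17) by simp
  finally have "m\<^sup>2 * (c * real (N + 1)) \<le> \<alpha>hi * (f (p 0) - fstar)"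
    by (simp add: mult_ac)
  then have "m\<^sup>2 \<le> \<alpha>hi * (f (p 0) - fstar) / (c * real (N + 1))"
    by (subst pos_le_divide_eq) (use c in auto)
  then have "m \<le> sqrt (\<alpha>hi * (f (p 0) - fstar) / (c * real (N + 1)))"
    by (rule real_le_rsqrt)
  then show ?thesis
    by (simp add: m_def d_def c_def real_sqrt_divide real_sqrt_mult)
qed

end
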